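(* Let $(X,M,* )$ be a fuzzy metric space having a fuzzy metric completion $(\tilde{X},\tilde{M},\tilde{*})$. Then the following conditions are equivalent: (a) $(\tilde{X},\tilde{M},\tilde{*})$ is weak $G$-complete. (b) Every subset of $X$ that is complete (as a fuzzy metric subspace) is weak $G$-complete (as a fuzzy metric subspace). (c) Given any fuzzy metric space $(Y,N,\star)$ and any fuzzy Cauchy-continuous map $f:(X,M,* )\to(Y,N,\star)$, $f$ takes every $G$-Cauchy sequence of $(X,M,* )$ to a fuzzy cofinally Cauchy sequence of $(Y,N,\star)$. (d) Given any fuzzy Cauchy-continuous map $f:(X,M,* )\to\mathbb R$, where $\mathbb R$ is endowed with the standard fuzzy metric induced by the usual metric, $f$ takes every $G$-Cauchy sequence of $(X,M,* )$ to a fuzzy cofinally Cauchy sequence of $\mathbb R$. (e) Every $G$-Cauchy sequence in $(X,M,* )$ has a Cauchy subsequence.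
   Context: A continuous $t$-norm is a continuous, associative, commutative binary operation $*$ on $[0,1]$ with $a*1=a$ for all $a$, and $a*b\le c*d$ whenever $a\le c$, $b\le d$. A fuzzy metric space (George–Veeramani) is a triple $(X,M,* )$ where $X$ is a nonempty set, $*$ is a continuous $t$-norm and $M:X\times X\times(0,\infty)\to[0,1]$ satisfies, for all $x,y,z\in X$ and $s,t>0$: $M(x,y,t)>0$; $M(x,y,t)=1\iff x=y$; $M(x,y,t)=M(y,x,t)$; $M(x,y,t)*M(y,z,s)\le M(x,z,t+s)$; $M(x,y,\cdot):(0,\infty)\to[0,1]$ is continuous. The topology $\tau_M$ on $X$ is the one with base $\{B(x,r,t):x\in X,\ r\in(0,1),\ t>0\}$, where $B(x,r,t)=\{y\in X:M(x,y,t)>1-r\}$. A sequence converges (resp. clusters, i.e. has a cluster point) in $(X,M,* )$ if it does so in $(X,\tau_M)$. For nonempty $A\subset X$, the fuzzy metric subspace on $A$ is $(A,M_A,* )$ with $M_A=M|_{A\times A\times(0,\infty)}$. The standard fuzzy metric on $\mathbb R$ induced by the usual metric is $(M_d,\cdot)$ with $M_d(x,y,t)=\frac{t}{t+|x-y|}$ and $\cdot$ the usual multiplication. A sequence $(x_n)$ in $(X,M,* )$ is Cauchy if for all $\epsilon\in(0,1)$, $t>0$ there is $k\in\mathbb N$ with $M(x_m,x_n,t)>1-\epsilon$ for all $m,n\ge k$; $(X,M,* )$ is complete if every Cauchy sequence in it converges. The sequence is $G$-Cauchy if $\lim_{n\to\infty}M(x_n,x_{n+1},t)=1$ for all $t>0$.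 A fuzzy metric space is weak $G$-complete if every $G$-Cauchy sequence in it clusters. The sequence is fuzzy cofinally Cauchy if for all $\epsilon\in(0,1)$ and $t>0$ there is an infinite subset $\mathbb N_\epsilon$ of $\mathbb N$ (depending on $\epsilon$ and $t$) such that $M(x_p,x_q,t)>1-\epsilon$ for all $p,q\in\mathbb N_\epsilon$. A map $f:X\to Y$ between fuzzy metric spaces $(X,M,* )$ and $(Y,N,\star)$ is fuzzy Cauchy-continuous if it takes every Cauchy sequence of $(X,M,* )$ to a Cauchy sequence of $(Y,N,\star)$; it is an isometry if $M(x,y,t)=N(f(x),f(y),t)$ for all $x,y\in X$, $t>0$, and the two spaces are isometric if there is an isometry of $X$ onto $Y$. A fuzzy metric completion of $(X,M,* )$ is a complete fuzzy metric space $(\tilde X,\tilde M,\tilde * )$ such that $(X,M,* )$ is isometric to a dense (with respect to $\tau_{\tilde M}$) subspace of it. *)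

theory Defs
  imports "HOL-Analysis.Analysis"
begin

text \<open>
  A fuzzy metric space is given by a carrier set \<open>X\<close>, a total function \<open>M\<close> and a total binary
  operation \<open>T\<close> on the reals (the t-norm). Only the values of \<open>M x y t\<close> for \<open>x\<close>, \<open>y\<close> in \<open>X\<close>
  and \<open>t > 0\<close>, and of \<open>T\<close> on the unit interval, are constrained or used. Hence the fuzzy metric
  subspace on \<open>A\<close> is just \<open>A\<close> with the same \<open>M\<close> and \<open>T\<close>. The notions below that do not involve the
  t-norm take only \<open>X\<close> and \<open>M\<close> as arguments.
\<close>

locale continuous_t_norm =
  fixes T :: "real \<Rightarrow> real \<Rightarrow> real"
  assumes T_closed: "\<lbrakk>a \<in> {0..1}; b \<in> {0..1}\<rbrakk> \<Longrightarrow> T a b \<in> {0..1}"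
    and T_continuous: "continuous_on ({0..1} \<times> {0..1}) (\<lambda>(a, b). T a b)"
    and T_assoc: "\<lbrakk>a \<in> {0..1}; b \<in> {0..1}; c \<in> {0..1}\<rbrakk> \<Longrightarrow> T (T a b) c = T a (T b c)"
    and T_commute: "\<lbrakk>a \<in> {0..1}; b \<in> {0..1}\<rbrakk> \<Longrightarrow> T a b = T b a"
    and T_one: "a \<in> {0..1} \<Longrightarrow> T a 1 = a"
    and T_mono: "\<lbrakk>a \<in> {0..1}; b \<in> {0..1}; c \<in> {0..1}; d \<in> {0..1}; a \<le> c; b \<le> d\<rbrakk>
                   \<Longrightarrow> T a b \<le> T c d"

locale fuzzy_metric_space = continuous_t_norm T
  for X :: "'a set" and M :: "'a \<Rightarrow> 'a \<Rightarrow> real \<Rightarrow> real" and T :: "real \<Rightarrow> real \<Rightarrow> real" +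
  assumes nonempty: "X \<noteq> {}"
    and M_range: "\<lbrakk>x \<in> X; y \<in> X; t > 0\<rbrakk> \<Longrightarrow> M x y t \<in> {0..1}"
    and M_pos: "\<lbrakk>x \<in> X; y \<in> X; t > 0\<rbrakk> \<Longrightarrow> M x y t > 0"
    and M_eq_1_iff: "\<lbrakk>x \<in> X; y \<in> X; t > 0\<rbrakk> \<Longrightarrow> M x y t = 1 \<longleftrightarrow> x = y"
    and M_sym: "\<lbrakk>x \<in> X; y \<in> X; t > 0\<rbrakk> \<Longrightarrow> M x y t = M y x t"
    and M_triangle: "\<lbrakk>x \<in> X; y \<in> X; z \<in> X; s > 0; t > 0\<rbrakk>
                       \<Longrightarrow> T (M x y t) (M y z s) \<le> M x z (t + s)"
    and M_continuous: "\<lbrakk>x \<in> X; y \<in> X\<rbrakk> \<Longrightarrow> continuous_on {0<..} (M x y)"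

definition fuzzy_ball ::
    "'a set \<Rightarrow> ('a \<Rightarrow> 'a \<Rightarrow> real \<Rightarrow> real) \<Rightarrow> 'a \<Rightarrow> real \<Rightarrow> real \<Rightarrow> 'a set" where
  "fuzzy_ball X M x r t = {y \<in> X. M x y t > 1 - r}"

text \<open>
  The balls do form a base in a fuzzy metric space, so that this is the intended topology:
  see \<open>openin_fuzzy_topology\<close> below.
\<close>

definition fuzzy_topology :: "'a set \<Rightarrow> ('a \<Rightarrow> 'a \<Rightarrow> real \<Rightarrow> real) \<Rightarrow> 'a topology" where
  "fuzzy_topology X M =
     topology (arbitrary union_of
       (\<lambda>B. \<exists>x\<in>X. \<exists>r\<in>{0<..<1}. \<exists>t>0. B = fuzzy_ball X M x r t))"

definition cluster_point :: "'a topology \<Rightarrow> (nat \<Rightarrow> 'a) \<Rightarrow> 'a \<Rightarrow> bool" where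
  "cluster_point \<tau> \<sigma> l \<longleftrightarrow>
     l \<in> topspace \<tau> \<and>
     (\<forall>U. openin \<tau> U \<and> l \<in> U \<longrightarrow> (\<exists>\<^sub>F n in sequentially. \<sigma> n \<in> U))"

definition fuzzy_Cauchy ::
    "'a set \<Rightarrow> ('a \<Rightarrow> 'a \<Rightarrow> real \<Rightarrow> real) \<Rightarrow> (nat \<Rightarrow> 'a) \<Rightarrow> bool" where
  "fuzzy_Cauchy X M \<sigma> \<longleftrightarrow>
     range \<sigma> \<subseteq> X \<and>
     (\<forall>\<epsilon>\<in>{0<..<1}. \<forall>t>0. \<exists>k. \<forall>m\<ge>k. \<forall>n\<ge>k. M (\<sigma> m) (\<sigma> n) t > 1 - \<epsilon>)"

definition fuzzy_complete :: "'a set \<Rightarrow> ('a \<Rightarrow> 'a \<Rightarrow> real \<Rightarrow> real) \<Rightarrow> bool" where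
  "fuzzy_complete X M \<longleftrightarrow>
     (\<forall>\<sigma>. fuzzy_Cauchy X M \<sigma> \<longrightarrow> (\<exists>l. limitin (fuzzy_topology X M) \<sigma> l sequentially))"

definition G_Cauchy ::
    "'a set \<Rightarrow> ('a \<Rightarrow> 'a \<Rightarrow> real \<Rightarrow> real) \<Rightarrow> (nat \<Rightarrow> 'a) \<Rightarrow> bool" where
  "G_Cauchy X M \<sigma> \<longleftrightarrow>
     range \<sigma> \<subseteq> X \<and> (\<forall>t>0. (\<lambda>n. M (\<sigma> n) (\<sigma> (Suc n)) t) \<longlonglongrightarrow> 1)"

definition weak_G_complete :: "'a set \<Rightarrow> ('a \<Rightarrow> 'a \<Rightarrow> real \<Rightarrow> real) \<Rightarrow> bool" where
  "weak_G_complete X M \<longleftrightarrow>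
     (\<forall>\<sigma>. G_Cauchy X M \<sigma> \<longrightarrow> (\<exists>l. cluster_point (fuzzy_topology X M) \<sigma> l))"

definition fuzzy_cofinally_Cauchy ::
    "'a set \<Rightarrow> ('a \<Rightarrow> 'a \<Rightarrow> real \<Rightarrow> real) \<Rightarrow> (nat \<Rightarrow> 'a) \<Rightarrow> bool" where
  "fuzzy_cofinally_Cauchy X M \<sigma> \<longleftrightarrow>
     range \<sigma> \<subseteq> X \<and>
     (\<forall>\<epsilon>\<in>{0<..<1}. \<forall>t>0. \<exists>I::nat set. infinite I \<and>
        (\<forall>p\<in>I. \<forall>q\<in>I. M (\<sigma> p) (\<sigma> q) t > 1 - \<epsilon>))"

definition fuzzy_Cauchy_continuous ::
    "'a set \<Rightarrow> ('a \<Rightarrow> 'a \<Rightarrow> real \<Rightarrow> real) \<Rightarrow> 'b set \<Rightarrow> ('b \<Rightarrow> 'b \<Rightarrow> real \<Rightarrow> real) \<Rightarrow> ('a \<Rightarrow> 'b) \<Rightarrow> bool"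
  where
  "fuzzy_Cauchy_continuous X M Y N f \<longleftrightarrow>
     f ` X \<subseteq> Y \<and> (\<forall>\<sigma>. fuzzy_Cauchy X M \<sigma> \<longrightarrow> fuzzy_Cauchy Y N (f \<circ> \<sigma>))"

definition fuzzy_isometry ::
    "'a set \<Rightarrow> ('a \<Rightarrow> 'a \<Rightarrow> real \<Rightarrow> real) \<Rightarrow> 'b set \<Rightarrow> ('b \<Rightarrow> 'b \<Rightarrow> real \<Rightarrow> real) \<Rightarrow> ('a \<Rightarrow> 'b) \<Rightarrow> bool"
  where
  "fuzzy_isometry X M Y N f \<longleftrightarrow>
     f ` X \<subseteq> Y \<and> (\<forall>x\<in>X. \<forall>y\<in>X. \<forall>t>0. M x y t = N (f x) (f y) t)"

definition fuzzy_isometric ::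
    "'a set \<Rightarrow> ('a \<Rightarrow> 'a \<Rightarrow> real \<Rightarrow> real) \<Rightarrow> 'b set \<Rightarrow> ('b \<Rightarrow> 'b \<Rightarrow> real \<Rightarrow> real) \<Rightarrow> bool" where
  "fuzzy_isometric X M Y N \<longleftrightarrow> (\<exists>f. fuzzy_isometry X M Y N f \<and> f ` X = Y)"

text \<open>The t-norms of a space and of its completion need not be related.\<close>

definition fuzzy_completion ::
    "'a set \<Rightarrow> ('a \<Rightarrow> 'a \<Rightarrow> real \<Rightarrow> real) \<Rightarrow>
     'b set \<Rightarrow> ('b \<Rightarrow> 'b \<Rightarrow> real \<Rightarrow> real) \<Rightarrow> (real \<Rightarrow> real \<Rightarrow> real) \<Rightarrow> bool" where
  "fuzzy_completion X M X' M' T' \<longleftrightarrow>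
     fuzzy_metric_space X' M' T' \<and> fuzzy_complete X' M' \<and>
     (\<exists>D\<subseteq>X'. fuzzy_isometric X M D M' \<and>
        fuzzy_topology X' M' closure_of D = topspace (fuzzy_topology X' M'))"

definition standard_fuzzy_metric :: "real \<Rightarrow> real \<Rightarrow> real \<Rightarrow> real" where
  "standard_fuzzy_metric x y t = t / (t + \<bar>x - y\<bar>)"

lemma fuzzy_metric_space_standard:
  "fuzzy_metric_space UNIV standard_fuzzy_metric (*)"
proof
  show "continuous_on ({0..1} \<times> {0..1}) (\<lambda>(a, b). a * b :: real)"
    by (auto simp: case_prod_unfold intro!: continuous_intros)
next
  fix x y z s t :: real
  assume st: "s > 0" "t > 0"
  define a b where "a = \<bar>x - y\<bar>" and "b = \<bar>y - z\<bar>"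
  have ab: "a \<ge> 0" "b \<ge> 0" "\<bar>x - z\<bar> \<le> a + b"
    by (auto simp: a_def b_def)
  have "t / (t + a) * (s / (s + b)) = t * s / ((t + a) * (s + b))"
    by simp
  also have "\<dots> \<le> (t + s) / (t + s + (a + b))"
  proof -
    have "t * s * (t + s + (a + b)) \<le> (t + s) * ((t + a) * (s + b))"
    proof -
      have "(t + s) * ((t + a) * (s + b)) - t * s * (t + s + (a + b))
              = t * t * b + s * s * a + t * a * b + s * a * b"
        by (simp add: algebra_simps)
      moreover have "\<dots> \<ge> 0"
        using st ab by (intro add_nonneg_nonneg mult_nonneg_nonneg) auto
      ultimately show ?thesis by linarith
    qed
    then show ?thesis
      using st ab by (simp add: pos_divide_le_eq pos_le_divide_eq add_pos_nonneg)
  qed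
  also have "\<dots> \<le> (t + s) / (t + s + \<bar>x - z\<bar>)"
    using st ab by (intro divide_left_mono mult_pos_pos) auto
  finally show "standard_fuzzy_metric x y t * standard_fuzzy_metric y z s
                  \<le> standard_fuzzy_metric x z (t + s)"
    by (simp add: standard_fuzzy_metric_def a_def b_def)
next
  fix x y :: real
  have "t + \<bar>x - y\<bar> \<noteq> 0" if "t > 0" for t
    using that by linarith
  then show "continuous_on {0<..} (standard_fuzzy_metric x y)"
    unfolding standard_fuzzy_metric_def by (intro continuous_intros) auto
qed (auto simp: standard_fuzzy_metric_def mult_le_one mult_mono abs_minus_commute
       add_pos_nonneg divide_simps)

context fuzzy_metric_space
begin

lemma M_mono:
  assumes "x \<in> X" "y \<in> X" "0 < s" "s \<le> t"
  shows "M x y s \<le> M x y t"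
proof (cases "s = t")
  case False
  then have "T (M x y s) (M y y (t - s)) \<le> M x y (s + (t - s))"
    using assms by (intro M_triangle) auto
  moreover have "M y y (t - s) = 1"
    using assms False by (subst M_eq_1_iff) auto
  ultimately show ?thesis
    using T_one[OF M_range[of x y s]] assms by simp
qed simp

lemma fuzzy_ball_nested:
  assumes "x \<in> X" "t > 0" "y \<in> fuzzy_ball X M x r t"
  obtains r' t' where "r' \<in> {0<..<1}" "t' > 0"
    "fuzzy_ball X M y r' t' \<subseteq> fuzzy_ball X M x r t"
proof -
  have y: "y \<in> X" "M x y t > 1 - r"
    using assms by (auto simp: fuzzy_ball_def)
  have "(M x y \<longlongrightarrow> M x y t) (at t)"
    using M_continuous[OF \<open>x \<in> X\<close> \<open>y \<in> X\<close>] \<open>t > 0\<close>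
    by (simp add: continuous_on_eq_continuous_at isCont_def)
  from order_tendstoD(1)[OF this y(2)]
  have "\<forall>\<^sub>F s in at_left t. M x y s > 1 - r"
    by (rule filter_leD[OF at_le, rotated]) auto
  moreover have "\<forall>\<^sub>F s in at_left t. s \<in> {0<..<t}"
    using \<open>t > 0\<close> by (rule eventually_at_left_real)
  ultimately have "\<forall>\<^sub>F s in at_left t. M x y s > 1 - r \<and> s \<in> {0<..<t}"
    by (rule eventually_conj)
  then obtain s where s: "M x y s > 1 - r" "0 < s" "s < t"
    using eventually_happens'[OF trivial_limit_at_left_real] by auto
  define a where "a = M x y s"
  have a: "a \<in> {0..1}"
    using M_range assms y s by (simp add: a_def)
  have "continuous_on {0..1} (\<lambda>b. (\<lambda>(a, b). T a b) (a, b))"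
    by (rule continuous_on_compose2[OF T_continuous]) (use a in \<open>auto intro!: continuous_intros\<close>)
  then have "continuous_on {0..1} (T a)"
    by simp
  moreover have "T a 1 - (1 - r) > 0"
    using s a T_one by (simp add: a_def)
  ultimately obtain d where d: "d > 0"
    "\<And>b. b \<in> {0..1} \<Longrightarrow> dist b 1 < d \<Longrightarrow> dist (T a b) (T a 1) < T a 1 - (1 - r)"
    unfolding continuous_on_iff by (metis atLeastAtMost_iff order_refl zero_le_one)
  define r' where "r' = min d (1 / 2)"
  show thesis
  proof
    show "r' \<in> {0<..<1}" using d by (auto simp: r'_def)
    show "t - s > 0" using s by simp
    show "fuzzy_ball X M y r' (t - s) \<subseteq> fuzzy_ball X M x r t"
    proof
      fix z assume "z \<in> fuzzy_ball X M y r' (t - s)"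
      then have z: "z \<in> X" "M y z (t - s) > 1 - d"
        by (auto simp: fuzzy_ball_def r'_def)
      have rng: "M y z (t - s) \<in> {0..1}"
        using M_range y z s by simp
      then have "T a (M y z (t - s)) > 1 - r"
        using d(2)[OF rng] z by (auto simp: dist_real_def)
      moreover have "T a (M y z (t - s)) \<le> M x z (s + (t - s))"
        unfolding a_def using assms y z s by (intro M_triangle) auto
      ultimately show "z \<in> fuzzy_ball X M x r t"
        using z by (simp add: fuzzy_ball_def)
    qed
  qed
qed

lemma fuzzy_ball_mono:
  assumes "x \<in> X" "0 < t" "t \<le> t'" "r \<le> r'"
  shows "fuzzy_ball X M x r t \<subseteq> fuzzy_ball X M x r' t'"
proof
  fix y assume y: "y \<in> fuzzy_ball X M x r t"
  with M_mono[of x y t t'] assms show "y \<in> fuzzy_ball X M x r' t'"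
    by (auto simp: fuzzy_ball_def)
qed

lemma centre_in_fuzzy_ball: "\<lbrakk>x \<in> X; r > 0; t > 0\<rbrakk> \<Longrightarrow> x \<in> fuzzy_ball X M x r t"
  using M_eq_1_iff[of x x t] by (auto simp: fuzzy_ball_def)

lemma openin_fuzzy_topology:
  "openin (fuzzy_topology X M) U \<longleftrightarrow>
     U \<subseteq> X \<and> (\<forall>x\<in>U. \<exists>r\<in>{0<..<1}. \<exists>t>0. fuzzy_ball X M x r t \<subseteq> U)"
proof -
  define P where "P U \<longleftrightarrow> U \<subseteq> X \<and> (\<forall>x\<in>U. \<exists>r\<in>{0<..<1}. \<exists>t>0. fuzzy_ball X M x r t \<subseteq> U)"
    for U
  have "istopology P"
    unfolding istopology_def
  proof (intro conjI allI impI)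
    fix S U assume SU: "P S" "P U"
    show "P (S \<inter> U)"
      unfolding P_def
    proof (intro conjI ballI)
      fix x assume x: "x \<in> S \<inter> U"
      obtain r t where 1: "r \<in> {0<..<1}" "t > 0" "fuzzy_ball X M x r t \<subseteq> S"
        using SU x unfolding P_def by blast
      obtain r' t' where 2: "r' \<in> {0<..<1}" "t' > 0" "fuzzy_ball X M x r' t' \<subseteq> U"
        using SU x unfolding P_def by blast
      have "x \<in> X" using x SU by (auto simp: P_def)
      then have "fuzzy_ball X M x (min r r') (min t t') \<subseteq> S \<inter> U"
        using fuzzy_ball_mono[of x "min t t'" t "min r r'" r]
          fuzzy_ball_mono[of x "min t t'" t' "min r r'" r'] 1 2 by auto
      then show "\<exists>r\<in>{0<..<1}. \<exists>t>0. fuzzy_ball X M x r t \<subseteq> S \<inter> U"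
        using 1 2 by (intro bexI[of _ "min r r'"] exI[of _ "min t t'"]) auto
    qed (use SU in \<open>auto simp: P_def\<close>)
  next
    fix K assume K: "\<forall>S\<in>K. P S"
    show "P (\<Union>K)"
      unfolding P_def
    proof (intro conjI ballI)
      fix x assume "x \<in> \<Union>K"
      then obtain S where S: "S \<in> K" "x \<in> S" by blast
      with K obtain r t where "r \<in> {0<..<1}" "t > 0" "fuzzy_ball X M x r t \<subseteq> S"
        unfolding P_def by meson
      with S show "\<exists>r\<in>{0<..<1}. \<exists>t>0. fuzzy_ball X M x r t \<subseteq> \<Union>K"
        by blast
    qed (use K in \<open>auto simp: P_def\<close>)
  qed
  then have P: "openin (topology P) = P"
    by (rule topology_inverse')
  have "fuzzy_topology X M = topology P"
    unfolding fuzzy_topology_def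
  proof (rule topology_base_unique)
    fix B assume "\<exists>x\<in>X. \<exists>r\<in>{0<..<1}. \<exists>t>0. B = fuzzy_ball X M x r t"
    then obtain x r t where B: "x \<in> X" "t > 0" "B = fuzzy_ball X M x r t"
      by blast
    then have "P B"
      unfolding P_def by (metis (no_types, lifting) fuzzy_ball_def fuzzy_ball_nested mem_Collect_eq subsetI)
    with P show "openin (topology P) B" by simp
  next
    fix U x assume "openin (topology P) U" "x \<in> U"
    then have "P U" "x \<in> U" "x \<in> X" by (auto simp: P P_def)
    then obtain r t where "r \<in> {0<..<1}" "t > 0" "fuzzy_ball X M x r t \<subseteq> U"
      unfolding P_def by blast
    with \<open>x \<in> X\<close> centre_in_fuzzy_ball[of x r t]
    show "\<exists>B. (\<exists>x\<in>X. \<exists>r\<in>{0<..<1}. \<exists>t>0. B = fuzzy_ball X M x r t) \<and> x \<in> B \<and> B \<subseteq> U"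
      by (intro exI[of _ "fuzzy_ball X M x r t"] conjI bexI[of _ x] bexI[of _ r] exI[of _ t]) auto
  qed
  with P show ?thesis by (simp add: P_def)
qed

lemma topspace_fuzzy_topology: "topspace (fuzzy_topology X M) = X"
proof (rule antisym)
  show "topspace (fuzzy_topology X M) \<subseteq> X"
    by (meson openin_fuzzy_topology openin_topspace)
  have "openin (fuzzy_topology X M) X"
    unfolding openin_fuzzy_topology
    by (intro conjI ballI bexI[of _ "1/2"] exI[of _ 1]) (auto simp: fuzzy_ball_def)
  then show "X \<subseteq> topspace (fuzzy_topology X M)"
    by (rule openin_subset)
qed

end

end

theory Submission
  imports Defs
begin

text \<open>
  The condition that carries the whole theorem is (e), that G-Cauchy sequences have Cauchy
  subsequences. Most of the work is calculus with the relation \<open>fuzzy_close M F u v\<close>, saying that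
  \<open>M (u i) (v i) t\<close> tends to 1 along \<open>F\<close> for every \<open>t > 0\<close>. By continuity of the t-norm at
  \<open>(1, 1)\<close> this relation is transitive, and being Cauchy, being G-Cauchy and converging are all
  instances of it.

  Conditions (a) and (e) are equivalent for two reasons. In a complete space a cluster point of a
  sequence is the same as the limit of a Cauchy subsequence (\<open>weak_G_complete_iff\<close>). And (e) passes
  between a space and a dense subspace, because a G-Cauchy sequence may be replaced by a
  sequence of the dense subspace whose distance to it vanishes
  (\<open>G_Cauchy_subseq_Cauchy_dense_iff\<close>).

  From (e), a complete subspace inherits the Cauchy subsequences and has their limits, which
  gives (b); and a Cauchy-continuous map preserves them, which gives (c) and its special case (d),
  since a sequence with a Cauchy subsequence is cofinally Cauchy.

  Conversely, let \<open>\<sigma>\<close> be a G-Cauchy sequence without Cauchy subsequence. Its range is complete,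
  since a Cauchy sequence in it has a constant subsequence or else yields a Cauchy subsequence of
  \<open>\<sigma>\<close>; but \<open>\<sigma>\<close> does not cluster there, so (b) fails. In the completion, \<open>\<sigma>\<close> has no cluster point, so
  its range is closed and discrete. The completion is a normal space, so Tietze's theorem extends
  to it the function sending each term of \<open>\<sigma>\<close> to its first index. The extension is
  Cauchy-continuous by completeness, but among its values on \<open>\<sigma>\<close> every natural number occurs only
  finitely often, so they are not cofinally Cauchy and (d) fails.
\<close>

section \<open>Cluster points and extension of functions in topological spaces\<close>

lemma strict_mono_choice_frequently:
  fixes P :: "nat \<Rightarrow> nat \<Rightarrow> bool"
  assumes "\<And>k. \<exists>\<^sub>F n in sequentially. P k n"
  obtains r :: "nat \<Rightarrow> nat" where "strict_mono r" "\<And>k. P k (r k)"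
proof -
  have ex: "\<exists>n\<ge>N. P k n" for k N
    using assms[of k] by (simp add: frequently_sequentially)
  have "\<exists>r. \<forall>k. P k (r k) \<and> r k < r (Suc k)"
  proof (rule dependent_nat_choice)
    show "\<exists>n. P 0 n" using ex by blast
  next
    fix n k
    show "\<exists>m. P (Suc k) m \<and> n < m"
      using ex[of "Suc n" "Suc k"] by (meson Suc_le_lessD)
  qed
  then show thesis
    using that by (auto simp: strict_mono_Suc_iff)
qed

lemma cluster_point_subseq_limit:
  assumes "strict_mono r" "limitin \<tau> (\<sigma> \<circ> r) l sequentially"
  shows "cluster_point \<tau> \<sigma> l"
  unfolding cluster_point_def
proof (intro conjI allI impI)
  fix U assume "openin \<tau> U \<and> l \<in> U"
  then obtain N where N: "\<And>n. n \<ge> N \<Longrightarrow> \<sigma> (r n) \<in> U"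
    using assms(2) by (auto simp: limitin_def eventually_sequentially)
  show "\<exists>\<^sub>F n in sequentially. \<sigma> n \<in> U"
    unfolding frequently_sequentially
  proof
    fix m
    have "r (max N m) \<ge> m"
      using seq_suble[OF assms(1), of "max N m"] by simp
    then show "\<exists>n\<ge>m. \<sigma> n \<in> U" using N[of "max N m"] by auto
  qed
qed (use assms(2) in \<open>simp add: limitin_def\<close>)

lemma cluster_point_infinitely_often:
  assumes "infinite {n. \<sigma> n = l}" "l \<in> topspace \<tau>"
  shows "cluster_point \<tau> \<sigma> l"
  unfolding cluster_point_def
proof (intro conjI allI impI)
  fix U assume U: "openin \<tau> U \<and> l \<in> U"
  have "\<exists>\<^sub>F n in sequentially. \<sigma> n = l"
    using assms(1) by (simp add: frequently_cofinite flip: cofinite_eq_sequentially)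
  then show "\<exists>\<^sub>F n in sequentially. \<sigma> n \<in> U"
    by (rule frequently_elim1) (use U in simp)
qed (fact assms(2))

text \<open>Every point has a neighbourhood that contains only finitely many terms, and these can be
  removed from it, finite sets being closed.\<close>

lemma closedin_subset_range_no_cluster_point:
  assumes "t1_space \<tau>" "range \<sigma> \<subseteq> topspace \<tau>" "\<nexists>l. cluster_point \<tau> \<sigma> l" "E \<subseteq> range \<sigma>"
  shows "closedin \<tau> E"
proof -
  have "\<exists>W. openin \<tau> W \<and> y \<in> W \<and> W \<subseteq> topspace \<tau> - E" if y: "y \<in> topspace \<tau> - E" for y
  proof -
    obtain U where U: "openin \<tau> U" "y \<in> U" "\<forall>\<^sub>F n in sequentially. \<sigma> n \<notin> U"
      using assms(3) y by (auto simp: cluster_point_def frequently_def)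
    then have "finite {n. \<sigma> n \<in> U}"
      by (simp add: eventually_cofinite flip: cofinite_eq_sequentially)
    moreover have "E \<inter> U \<subseteq> \<sigma> ` {n. \<sigma> n \<in> U}"
      using assms(4) by auto
    ultimately have "finite (E \<inter> U)"
      by (meson finite_imageI finite_subset)
    moreover have "E \<inter> U \<subseteq> topspace \<tau>"
      using assms(2,4) by blast
    ultimately have "closedin \<tau> (E \<inter> U)"
      using assms(1) unfolding t1_space_closedin_finite by blast
    then have "openin \<tau> (U - E \<inter> U)"
      using U(1) by (rule openin_diff[rotated])
    then show ?thesis
      using U y openin_subset[OF U(1)] by (intro exI[of _ "U - E \<inter> U"]) auto
  qed
  then have "openin \<tau> (topspace \<tau> - E)"
    by (subst openin_subopen) blast
  then show ?thesis
    using assms(2,4) by (auto simp: closedin_def)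
qed

text \<open>The range of such a sequence is closed and discrete, so every function on it is continuous
  and Tietze's theorem applies.\<close>

lemma continuous_extension_no_cluster_point:
  fixes g :: "'a \<Rightarrow> real"
  assumes "normal_space \<tau>" "t1_space \<tau>" "range \<sigma> \<subseteq> topspace \<tau>" "\<nexists>l. cluster_point \<tau> \<sigma> l"
  obtains f where "continuous_map \<tau> euclideanreal f" "\<And>n. f (\<sigma> n) = g (\<sigma> n)"
proof -
  have closed: "closedin \<tau> E" if "E \<subseteq> range \<sigma>" for E
    using closedin_subset_range_no_cluster_point assms(2-4) that by metis
  have "continuous_map (subtopology \<tau> (range \<sigma>)) euclideanreal g"
    unfolding continuous_map_closedin
    by (auto intro!: closedin_subset_topspace closed)
  moreover have "closedin \<tau> (range \<sigma>)"
    using closed by blast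
  ultimately obtain f where "continuous_map \<tau> euclideanreal f" "\<forall>x\<in>range \<sigma>. f x = g x"
    using assms(1) unfolding normal_space_iff_Tietze by blast
  with that show thesis by blast
qed

section \<open>Asymptotic closeness\<close>

definition fuzzy_close ::
    "('a \<Rightarrow> 'a \<Rightarrow> real \<Rightarrow> real) \<Rightarrow> 'i filter \<Rightarrow> ('i \<Rightarrow> 'a) \<Rightarrow> ('i \<Rightarrow> 'a) \<Rightarrow> bool" where
  "fuzzy_close M F u v \<longleftrightarrow> (\<forall>t>0. ((\<lambda>i. M (u i) (v i) t) \<longlongrightarrow> 1) F)"

definition G_Cauchy_subseq_Cauchy :: "'a set \<Rightarrow> ('a \<Rightarrow> 'a \<Rightarrow> real \<Rightarrow> real) \<Rightarrow> bool" where
  "G_Cauchy_subseq_Cauchy X M \<longleftrightarrow>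
     (\<forall>\<sigma>. G_Cauchy X M \<sigma> \<longrightarrow> (\<exists>r::nat \<Rightarrow> nat. strict_mono r \<and> fuzzy_Cauchy X M (\<sigma> \<circ> r)))"

lemma fuzzy_close_compose:
  assumes "fuzzy_close M F u v" "filterlim h F G"
  shows "fuzzy_close M G (u \<circ> h) (v \<circ> h)"
  unfolding fuzzy_close_def
proof (intro allI impI)
  fix t :: real assume "t > 0"
  with assms(1) have "((\<lambda>i. M (u i) (v i) t) \<longlongrightarrow> 1) F"
    by (simp add: fuzzy_close_def)
  from filterlim_compose[OF this assms(2)]
  show "((\<lambda>i. M ((u \<circ> h) i) ((v \<circ> h) i) t) \<longlongrightarrow> 1) G"
    by simp
qed

lemma G_Cauchy_iff_fuzzy_close:
  "G_Cauchy X M \<sigma> \<longleftrightarrow> range \<sigma> \<subseteq> X \<and> fuzzy_close M sequentially \<sigma> (\<sigma> \<circ> Suc)"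
  by (simp add: G_Cauchy_def fuzzy_close_def)

lemma fuzzy_Cauchy_imp_cofinally_Cauchy:
  assumes "range \<sigma> \<subseteq> X" "strict_mono r" "fuzzy_Cauchy X M (\<sigma> \<circ> r)"
  shows "fuzzy_cofinally_Cauchy X M \<sigma>"
  unfolding fuzzy_cofinally_Cauchy_def
proof (intro conjI ballI allI impI)
  fix \<epsilon> t :: real assume "\<epsilon> \<in> {0<..<1}" "t > 0"
  then obtain k where k: "\<forall>m\<ge>k. \<forall>n\<ge>k. M (\<sigma> (r m)) (\<sigma> (r n)) t > 1 - \<epsilon>"
    using assms(3) unfolding fuzzy_Cauchy_def comp_def by blast
  have "inj_on r {k..}"
    using assms(2) strict_mono_on_imp_inj_on by (meson inj_on_subset subset_UNIV)
  then have "infinite (r ` {k..})"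
    by (simp add: finite_image_iff infinite_Ici)
  with k show "\<exists>I. infinite I \<and> (\<forall>p\<in>I. \<forall>q\<in>I. M (\<sigma> p) (\<sigma> q) t > 1 - \<epsilon>)"
    by (intro exI[of _ "r ` {k..}"]) auto
qed (fact assms(1))

lemma (in continuous_t_norm) T_tendsto_1:
  assumes "(a \<longlongrightarrow> 1) F" "(b \<longlongrightarrow> 1) F" "\<And>i. a i \<in> {0..1}" "\<And>i. b i \<in> {0..1}"
  shows "((\<lambda>i. T (a i) (b i)) \<longlongrightarrow> 1) F"
proof -
  have "((\<lambda>i. case (a i, b i) of (x, y) \<Rightarrow> T x y) \<longlongrightarrow> (case (1, 1) of (x, y) \<Rightarrow> T x y)) F"
    by (rule continuous_on_tendsto_compose[OF T_continuous tendsto_Pair[OF assms(1,2)]])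
      (use assms(3,4) in auto)
  then show ?thesis by (simp add: T_one)
qed

context fuzzy_metric_space
begin

lemma fuzzy_metric_space_subset: "\<lbrakk>A \<subseteq> X; A \<noteq> {}\<rbrakk> \<Longrightarrow> fuzzy_metric_space A M T"
  by unfold_locales
    (use M_range in \<open>auto simp: subset_iff M_pos M_eq_1_iff M_continuous intro: M_sym M_triangle\<close>)

lemma M_le_1: "\<lbrakk>x \<in> X; y \<in> X; t > 0\<rbrakk> \<Longrightarrow> M x y t \<le> 1"
  using M_range by simp

lemma fuzzy_close_iff:
  assumes "range u \<subseteq> X" "range v \<subseteq> X"
  shows "fuzzy_close M F u v \<longleftrightarrow>
    (\<forall>\<epsilon>\<in>{0<..<1}. \<forall>t>0. \<forall>\<^sub>F i in F. M (u i) (v i) t > 1 - \<epsilon>)" (is "_ \<longleftrightarrow> ?R")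
proof
  assume "fuzzy_close M F u v"
  then show ?R
    unfolding fuzzy_close_def by (auto intro: order_tendstoD(1))
next
  assume R: ?R
  show "fuzzy_close M F u v"
    unfolding fuzzy_close_def
  proof (intro allI impI)
    fix t :: real assume t: "t > 0"
    show "((\<lambda>i. M (u i) (v i) t) \<longlongrightarrow> 1) F"
    proof (rule order_tendstoI)
      fix a :: real assume "a < 1"
      then have "min (1 / 2) (1 - a) \<in> {0<..<1}" by auto
      with R t have "\<forall>\<^sub>F i in F. M (u i) (v i) t > 1 - min (1 / 2) (1 - a)" by blast
      then show "\<forall>\<^sub>F i in F. a < M (u i) (v i) t"
        by eventually_elim auto
    next
      fix a :: real assume "a > 1"
      then show "\<forall>\<^sub>F i in F. M (u i) (v i) t < a"
        using M_le_1 assms t by (intro always_eventually allI) (meson le_less_trans rangeI subsetD)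
    qed
  qed
qed

lemma fuzzy_close_sym:
  assumes "fuzzy_close M F u v" "range u \<subseteq> X" "range v \<subseteq> X"
  shows "fuzzy_close M F v u"
proof -
  have "M (v i) (u i) t = M (u i) (v i) t" if "t > 0" for i t
    using that assms by (intro M_sym) auto
  with assms(1) show ?thesis by (simp add: fuzzy_close_def)
qed

lemma fuzzy_close_trans:
  assumes "fuzzy_close M F u v" "fuzzy_close M F v w"
    and "range u \<subseteq> X" "range v \<subseteq> X" "range w \<subseteq> X"
  shows "fuzzy_close M F u w"
  unfolding fuzzy_close_def
proof (intro allI impI)
  fix t :: real assume t: "t > 0"
  have X: "u i \<in> X" "v i \<in> X" "w i \<in> X" for i
    using assms(3-5) by auto
  have lim: "((\<lambda>i. T (M (u i) (v i) (t / 2)) (M (v i) (w i) (t / 2))) \<longlongrightarrow> 1) F"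
    using assms(1,2) t X by (intro T_tendsto_1 M_range) (auto simp: fuzzy_close_def)
  have lower: "T (M (u i) (v i) (t / 2)) (M (v i) (w i) (t / 2)) \<le> M (u i) (w i) t" for i
    using M_triangle[OF X(1) X(2) X(3), of "t / 2" "t / 2" i i i] t by simp
  have upper: "M (u i) (w i) t \<le> 1" for i
    using X t by (intro M_le_1)
  show "((\<lambda>i. M (u i) (w i) t) \<longlongrightarrow> 1) F"
    by (rule tendsto_sandwich[OF always_eventually always_eventually lim tendsto_const])
      (simp_all add: lower upper)
qed

text \<open>A single parameter, serving both as radius and as time, is enough to test closeness.\<close>

lemma fuzzy_close_vanishing:
  assumes "\<And>i. M (u i) (v i) (\<delta> i) > 1 - \<delta> i" "\<And>i. \<delta> i > 0" "(\<delta> \<longlongrightarrow> 0) F"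
    and "range u \<subseteq> X" "range v \<subseteq> X"
  shows "fuzzy_close M F u v"
  unfolding fuzzy_close_iff[OF assms(4,5)]
proof (intro ballI allI impI)
  fix \<epsilon> t :: real assume "\<epsilon> \<in> {0<..<1}" "t > 0"
  then have "\<forall>\<^sub>F i in F. \<delta> i < min \<epsilon> t"
    by (intro order_tendstoD(2)[OF assms(3)]) auto
  then show "\<forall>\<^sub>F i in F. M (u i) (v i) t > 1 - \<epsilon>"
  proof eventually_elim
    case (elim i)
    have "M (u i) (v i) (\<delta> i) \<le> M (u i) (v i) t"
      using assms elim by (intro M_mono) auto
    with assms(1)[of i] elim show ?case by simp
  qed
qed

lemma fuzzy_Cauchy_iff_fuzzy_close:
  "fuzzy_Cauchy X M \<sigma> \<longleftrightarrow>
     range \<sigma> \<subseteq> X \<and> fuzzy_close M (sequentially \<times>\<^sub>F sequentially) (\<sigma> \<circ> fst) (\<sigma> \<circ> snd)"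
proof (cases "range \<sigma> \<subseteq> X")
  case True
  then have "range (\<sigma> \<circ> fst) \<subseteq> X" "range (\<sigma> \<circ> snd) \<subseteq> X" by auto
  note close_iff = fuzzy_close_iff[OF this]
  have "(\<forall>\<^sub>F p in sequentially \<times>\<^sub>F sequentially. M (\<sigma> (fst p)) (\<sigma> (snd p)) t > 1 - \<epsilon>) \<longleftrightarrow>
      (\<exists>k. \<forall>m\<ge>k. \<forall>n\<ge>k. M (\<sigma> m) (\<sigma> n) t > 1 - \<epsilon>)" for t \<epsilon>
    unfolding eventually_prod_sequentially fst_conv snd_conv by blast
  with True show ?thesis
    by (simp add: fuzzy_Cauchy_def close_iff)
qed (simp add: fuzzy_Cauchy_def)

section \<open>Limits, cluster points and separation\<close>

lemma openin_fuzzy_ball: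
  assumes "x \<in> X" "t > 0"
  shows "openin (fuzzy_topology X M) (fuzzy_ball X M x r t)"
  unfolding openin_fuzzy_topology
proof (intro conjI ballI)
  fix y assume "y \<in> fuzzy_ball X M x r t"
  from fuzzy_ball_nested[OF assms this]
  show "\<exists>r'\<in>{0<..<1}. \<exists>t'>0. fuzzy_ball X M y r' t' \<subseteq> fuzzy_ball X M x r t"
    by metis
qed (auto simp: fuzzy_ball_def)

lemma limitin_iff_fuzzy_close:
  assumes "range \<sigma> \<subseteq> X"
  shows "limitin (fuzzy_topology X M) \<sigma> l F \<longleftrightarrow> l \<in> X \<and> fuzzy_close M F (\<lambda>_. l) \<sigma>"
proof (cases "l \<in> X")
  case True
  then have iff: "fuzzy_close M F (\<lambda>_. l) \<sigma> \<longleftrightarrow>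
      (\<forall>r\<in>{0<..<1}. \<forall>t>0. \<forall>\<^sub>F i in F. \<sigma> i \<in> fuzzy_ball X M l r t)"
    using fuzzy_close_iff[of "\<lambda>_. l" \<sigma> F] assms by (auto simp: fuzzy_ball_def subset_iff)
  show ?thesis
  proof
    assume "limitin (fuzzy_topology X M) \<sigma> l F"
    then show "l \<in> X \<and> fuzzy_close M F (\<lambda>_. l) \<sigma>"
      using True openin_fuzzy_ball centre_in_fuzzy_ball unfolding iff limitin_def by auto
  next
    assume close: "l \<in> X \<and> fuzzy_close M F (\<lambda>_. l) \<sigma>"
    show "limitin (fuzzy_topology X M) \<sigma> l F"
      unfolding limitin_def topspace_fuzzy_topology
    proof (intro conjI allI impI)
      fix U assume "openin (fuzzy_topology X M) U \<and> l \<in> U"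
      then obtain r t where rt: "r \<in> {0<..<1}" "t > 0" "fuzzy_ball X M l r t \<subseteq> U"
        unfolding openin_fuzzy_topology by blast
      with close have "\<forall>\<^sub>F i in F. \<sigma> i \<in> fuzzy_ball X M l r t"
        unfolding iff by blast
      then show "\<forall>\<^sub>F i in F. \<sigma> i \<in> U"
        by (rule eventually_mono) (use rt(3) in blast)
    qed (fact True)
  qed
qed (auto simp: limitin_def topspace_fuzzy_topology)

lemma limitin_imp_fuzzy_Cauchy:
  assumes "limitin (fuzzy_topology X M) \<sigma> l sequentially" "range \<sigma> \<subseteq> X"
  shows "fuzzy_Cauchy X M \<sigma>"
proof -
  have l: "l \<in> X" "fuzzy_close M sequentially (\<lambda>_. l) \<sigma>"
    using assms limitin_iff_fuzzy_close by auto
  let ?F = "sequentially \<times>\<^sub>F sequentially :: (nat \<times> nat) filter"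
  have close: "fuzzy_close M ?F (\<lambda>_. l) (\<sigma> \<circ> fst)" "fuzzy_close M ?F (\<lambda>_. l) (\<sigma> \<circ> snd)"
    using fuzzy_close_compose[OF l(2) filterlim_fst] fuzzy_close_compose[OF l(2) filterlim_snd]
    by (simp_all add: comp_def)
  have X: "range (\<lambda>_. l) \<subseteq> X" "range (\<sigma> \<circ> fst) \<subseteq> X" "range (\<sigma> \<circ> snd) \<subseteq> X"
    using assms(2) l(1) by auto
  have "fuzzy_close M ?F (\<sigma> \<circ> fst) (\<sigma> \<circ> snd)"
    by (rule fuzzy_close_trans[OF fuzzy_close_sym[OF close(1) X(1,2)] close(2) X(2,1,3)])
  with assms(2) show ?thesis
    by (simp add: fuzzy_Cauchy_iff_fuzzy_close)
qed

lemma fuzzy_Cauchy_subseq_limit: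
  assumes "fuzzy_Cauchy X M \<sigma>" "strict_mono r"
    and "limitin (fuzzy_topology X M) (\<sigma> \<circ> r) l sequentially"
  shows "limitin (fuzzy_topology X M) \<sigma> l sequentially"
proof -
  have \<sigma>: "range \<sigma> \<subseteq> X" "fuzzy_close M (sequentially \<times>\<^sub>F sequentially) (\<sigma> \<circ> fst) (\<sigma> \<circ> snd)"
    using assms(1) by (auto simp: fuzzy_Cauchy_iff_fuzzy_close)
  then have rX: "range (\<sigma> \<circ> r) \<subseteq> X" by auto
  have l: "l \<in> X" "fuzzy_close M sequentially (\<lambda>_. l) (\<sigma> \<circ> r)"
    using assms(3) rX by (simp_all add: limitin_iff_fuzzy_close)
  \<comment> \<open>Restricting the Cauchy condition to these pairs of indices compares \<open>\<sigma>\<close> with its subsequence.\<close>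
  have "filterlim (\<lambda>n. (r n, n)) (sequentially \<times>\<^sub>F sequentially) sequentially"
    using assms(2) by (intro filterlim_Pair filterlim_subseq filterlim_ident)
  from fuzzy_close_compose[OF \<sigma>(2) this]
  have "fuzzy_close M sequentially (\<sigma> \<circ> r) \<sigma>"
    by (simp add: comp_def)
  from fuzzy_close_trans[OF l(2) this _ rX \<sigma>(1)] l(1) \<sigma>(1) show ?thesis
    by (auto simp: limitin_iff_fuzzy_close)
qed

text \<open>The topology is first countable: the balls of radius and time \<open>1 / (k + 1)\<close> suffice at every
  point.\<close>

lemma cluster_point_iff_subseq:
  assumes "range \<sigma> \<subseteq> X"
  shows "cluster_point (fuzzy_topology X M) \<sigma> l \<longleftrightarrow>
    (\<exists>r::nat \<Rightarrow> nat. strict_mono r \<and> limitin (fuzzy_topology X M) (\<sigma> \<circ> r) l sequentially)"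
proof
  assume cl: "cluster_point (fuzzy_topology X M) \<sigma> l"
  define \<delta> :: "nat \<Rightarrow> real" where "\<delta> k = 1 / real (Suc k)" for k
  have l: "l \<in> X" and \<delta>: "\<delta> k > 0" for k
    using cl by (simp_all add: cluster_point_def topspace_fuzzy_topology \<delta>_def)
  have "\<exists>\<^sub>F n in sequentially. \<sigma> n \<in> fuzzy_ball X M l (\<delta> k) (\<delta> k)" for k
    using cl openin_fuzzy_ball[OF l \<delta>] centre_in_fuzzy_ball[OF l \<delta> \<delta>]
    by (simp add: cluster_point_def)
  then obtain r :: "nat \<Rightarrow> nat"
    where r: "strict_mono r" "\<And>k. \<sigma> (r k) \<in> fuzzy_ball X M l (\<delta> k) (\<delta> k)"
    using strict_mono_choice_frequently[of "\<lambda>k n. \<sigma> n \<in> fuzzy_ball X M l (\<delta> k) (\<delta> k)"] by blast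
  have rX: "range (\<sigma> \<circ> r) \<subseteq> X"
    using assms by auto
  have "\<delta> \<longlonglongrightarrow> 0"
    unfolding \<delta>_def by (rule LIMSEQ_Suc[OF lim_1_over_n])
  then have "fuzzy_close M sequentially (\<lambda>_. l) (\<sigma> \<circ> r)"
    using r(2) \<delta> l rX by (intro fuzzy_close_vanishing[where \<delta> = \<delta>]) (auto simp: fuzzy_ball_def)
  with r(1) l rX
  show "\<exists>r::nat \<Rightarrow> nat. strict_mono r \<and> limitin (fuzzy_topology X M) (\<sigma> \<circ> r) l sequentially"
    by (auto simp: limitin_iff_fuzzy_close)
qed (blast intro: cluster_point_subseq_limit)

lemma t1_space_fuzzy_topology: "t1_space (fuzzy_topology X M)"
  unfolding t1_space_def topspace_fuzzy_topology
proof (intro ballI impI)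
  fix x y assume xy: "x \<in> X" "y \<in> X" "x \<noteq> y"
  then have "M x y 1 < 1"
    using M_le_1[of x y 1] M_eq_1_iff[of x y 1] by simp
  with xy have "x \<in> fuzzy_ball X M x (1 - M x y 1) 1"
    by (intro centre_in_fuzzy_ball) auto
  moreover have "y \<notin> fuzzy_ball X M x (1 - M x y 1) 1"
    by (simp add: fuzzy_ball_def)
  moreover have "openin (fuzzy_topology X M) (fuzzy_ball X M x (1 - M x y 1) 1)"
    using xy by (intro openin_fuzzy_ball) auto
  ultimately show "\<exists>U. openin (fuzzy_topology X M) U \<and> x \<in> U \<and> y \<notin> U"
    by blast
qed

lemma openin_fuzzy_topology_diagonal:
  assumes "openin (fuzzy_topology X M) U" "x \<in> U"
  obtains \<delta> where "\<delta> \<in> {0<..<1}" "fuzzy_ball X M x \<delta> \<delta> \<subseteq> U"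
proof -
  obtain r t where rt: "r \<in> {0<..<1}" "t > 0" "fuzzy_ball X M x r t \<subseteq> U" and "x \<in> X"
    using assms by (metis openin_fuzzy_topology subsetD)
  then have "fuzzy_ball X M x (min r t) (min r t) \<subseteq> U"
    using fuzzy_ball_mono[of x "min r t" t "min r t" r] by auto
  with rt show thesis by (intro that[of "min r t"]) auto
qed

text \<open>The uniform analogue of halving a radius; the bound does not depend on the points.\<close>

lemma uniform_halving:
  assumes "\<delta> > 0"
  obtains \<eta> where "\<eta> > 0"
    "\<And>x y z. \<lbrakk>x \<in> X; y \<in> X; z \<in> X; M x z \<eta> > 1 - \<eta>; M z y \<eta> > 1 - \<eta>\<rbrakk> \<Longrightarrow> M x y \<delta> > 1 - \<delta>"
proof -
  obtain d where d: "d > 0"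
    "\<And>a b. \<lbrakk>a \<in> {0..1}; b \<in> {0..1}; dist (a, b) (1, 1) < d\<rbrakk> \<Longrightarrow> dist (T a b) (T 1 1) < \<delta>"
    using T_continuous assms unfolding continuous_on_iff by (fastforce dest: bspec[of _ _ "(1, 1)"])
  define \<eta> where "\<eta> = min (d / 2) (\<delta> / 2)"
  have \<eta>: "\<eta> > 0" "\<eta> \<le> d / 2" "\<eta> \<le> \<delta> / 2"
    using d(1) assms by (auto simp: \<eta>_def)
  show thesis
  proof (rule that[OF \<eta>(1)])
    fix x y z
    assume X: "x \<in> X" "y \<in> X" "z \<in> X" and M: "M x z \<eta> > 1 - \<eta>" "M z y \<eta> > 1 - \<eta>"
    have rng: "M x z \<eta> \<in> {0..1}" "M z y \<eta> \<in> {0..1}"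
      using X \<eta>(1) by (auto intro: M_range simp del: atLeastAtMost_iff)
    have "dist (M x z \<eta>, M z y \<eta>) (1, 1) \<le> dist (M x z \<eta>) 1 + dist (M z y \<eta>) 1"
      unfolding dist_Pair_Pair by (rule sqrt_sum_squares_le_sum) auto
    also have "\<dots> < \<eta> + \<eta>"
      using M rng by (intro add_strict_mono) (auto simp: dist_real_def)
    finally have "dist (T (M x z \<eta>) (M z y \<eta>)) (T 1 1) < \<delta>"
      using \<eta>(2) by (intro d(2) rng) linarith
    then have "1 - \<delta> < T (M x z \<eta>) (M z y \<eta>)"
      by (simp add: T_one dist_real_def)
    also have "\<dots> \<le> M x y (\<eta> + \<eta>)"
      using X \<eta> by (intro M_triangle) auto
    also have "\<dots> \<le> M x y \<delta>"
      using X \<eta> by (intro M_mono) auto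
    finally show "M x y \<delta> > 1 - \<delta>" .
  qed
qed

text \<open>As in a metric space, each point of one closed set gets a ball whose double misses the other
  set. If balls around a point of either set met, the double of the larger one would contain the
  centre of the other.\<close>

lemma normal_space_fuzzy_topology: "normal_space (fuzzy_topology X M)"
  unfolding normal_space_def
proof (intro allI impI)
  let ?\<tau> = "fuzzy_topology X M"
  \<comment> \<open>\<open>W R x \<eta>\<close>: two successive steps of size \<open>\<eta>\<close>, starting at \<open>x\<close>, cannot end in \<open>R\<close>.\<close>
  define W where "W R x \<eta> \<longleftrightarrow> x \<in> X \<and> \<eta> > 0 \<and>
    (\<forall>y\<in>R. \<forall>z\<in>X. M x z \<eta> > 1 - \<eta> \<longrightarrow> \<not> M z y \<eta> > 1 - \<eta>)" for R x \<eta>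
  define N where "N R Q = (\<Union>{fuzzy_ball X M x \<eta> \<eta> | x \<eta>. x \<in> Q \<and> W R x \<eta>})" for R Q
  have ex: "\<exists>\<eta>. W R x \<eta>" if R: "closedin ?\<tau> R" and x: "x \<in> X" "x \<notin> R" for R x
  proof -
    have "openin ?\<tau> (X - R)" "R \<subseteq> X"
      using R by (auto simp: closedin_def topspace_fuzzy_topology)
    then obtain \<delta> where \<delta>: "\<delta> \<in> {0<..<1}" "fuzzy_ball X M x \<delta> \<delta> \<subseteq> X - R"
      using openin_fuzzy_topology_diagonal x by (metis DiffI)
    obtain \<eta> where \<eta>: "\<eta> > 0"
      "\<And>x y z. \<lbrakk>x \<in> X; y \<in> X; z \<in> X; M x z \<eta> > 1 - \<eta>; M z y \<eta> > 1 - \<eta>\<rbrakk> \<Longrightarrow> M x y \<delta> > 1 - \<delta>"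
      using uniform_halving \<delta>(1) by (metis greaterThanLessThan_iff)
    have "W R x \<eta>"
      unfolding W_def
    proof (intro conjI ballI impI notI)
      fix y z assume "y \<in> R" "z \<in> X" "M x z \<eta> > 1 - \<eta>" "M z y \<eta> > 1 - \<eta>"
      with \<eta>(2)[of x y z] x \<open>R \<subseteq> X\<close> have "y \<in> fuzzy_ball X M x \<delta> \<delta>"
        by (auto simp: fuzzy_ball_def)
      with \<delta>(2) \<open>y \<in> R\<close> show False by blast
    qed (use x \<eta>(1) in auto)
    then show ?thesis by blast
  qed
  have nbhd: "openin ?\<tau> (N R Q) \<and> Q \<subseteq> N R Q"
    if R: "closedin ?\<tau> R" and Q: "closedin ?\<tau> Q" "disjnt Q R" for R Q
  proof
    show "openin ?\<tau> (N R Q)"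
      unfolding N_def by (rule openin_Union) (auto simp: W_def intro: openin_fuzzy_ball)
    show "Q \<subseteq> N R Q"
    proof
      fix x assume x: "x \<in> Q"
      then have "x \<in> X" "x \<notin> R"
        using Q closedin_subset[OF Q(1)] by (auto simp: topspace_fuzzy_topology disjnt_def)
      then obtain \<eta> where "W R x \<eta>" using ex[OF R] by blast
      moreover from this have "x \<in> fuzzy_ball X M x \<eta> \<eta>"
        by (auto simp: W_def intro: centre_in_fuzzy_ball)
      ultimately show "x \<in> N R Q" using x unfolding N_def by blast
    qed
  qed
  fix S R assume SR: "closedin ?\<tau> S \<and> closedin ?\<tau> R \<and> disjnt S R"
  \<comment> \<open>The larger size \<open>\<beta>\<close> also allows the step from \<open>z\<close> to \<open>a\<close>, so \<open>b\<close> reaches \<open>a\<close> in two steps.\<close>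
  have clash: False
    if ball: "z \<in> fuzzy_ball X M a \<alpha> \<alpha>" "z \<in> fuzzy_ball X M b \<beta> \<beta>"
      and a: "a \<in> A" "W B a \<alpha>" and b: "b \<in> B" "W A b \<beta>" and le: "\<alpha> \<le> \<beta>"
    for z a b \<alpha> \<beta> A B
  proof -
    have X: "a \<in> X" "b \<in> X" "z \<in> X" and pos: "\<alpha> > 0" "\<beta> > 0"
      using a(2) b(2) ball by (auto simp: W_def fuzzy_ball_def)
    have "M a z \<alpha> \<le> M a z \<beta>"
      using X pos le by (intro M_mono)
    then have "M a z \<beta> > 1 - \<beta>"
      using ball(1) le by (auto simp: fuzzy_ball_def)
    moreover have "M a z \<beta> = M z a \<beta>"
      using X pos by (intro M_sym)
    ultimately show False
      using ball(2) b(2) a(1) X(3) by (auto simp: W_def fuzzy_ball_def)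
  qed
  have "disjnt (N R S) (N S R)"
    unfolding disjnt_iff
  proof (intro allI notI)
    fix z assume "z \<in> N R S \<and> z \<in> N S R"
    then obtain a b \<alpha> \<beta> where "a \<in> S" "W R a \<alpha>" "z \<in> fuzzy_ball X M a \<alpha> \<alpha>"
      "b \<in> R" "W S b \<beta>" "z \<in> fuzzy_ball X M b \<beta> \<beta>"
      unfolding N_def by blast
    then show False
      using clash[of z a \<alpha> b \<beta>] clash[of z b \<beta> a \<alpha>] by (meson linear)
  qed
  then show "\<exists>U V. openin ?\<tau> U \<and> openin ?\<tau> V \<and> S \<subseteq> U \<and> R \<subseteq> V \<and> disjnt U V"
    using nbhd[of R S] nbhd[of S R] SR by (metis disjnt_sym)
qed

section \<open>Weak G-completeness and Cauchy subsequences\<close>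

lemma weak_G_complete_imp_G_Cauchy_subseq_Cauchy:
  assumes "weak_G_complete X M"
  shows "G_Cauchy_subseq_Cauchy X M"
  unfolding G_Cauchy_subseq_Cauchy_def
proof (intro allI impI)
  fix \<sigma> assume G: "G_Cauchy X M \<sigma>"
  then have \<sigma>: "range \<sigma> \<subseteq> X" by (simp add: G_Cauchy_def)
  from G assms obtain l where "cluster_point (fuzzy_topology X M) \<sigma> l"
    unfolding weak_G_complete_def by blast
  then obtain r :: "nat \<Rightarrow> nat"
    where "strict_mono r" "limitin (fuzzy_topology X M) (\<sigma> \<circ> r) l sequentially"
    using cluster_point_iff_subseq[OF \<sigma>] by blast
  moreover have "range (\<sigma> \<circ> r) \<subseteq> X" using \<sigma> by auto
  ultimately show "\<exists>r. strict_mono r \<and> fuzzy_Cauchy X M (\<sigma> \<circ> r)"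
    using limitin_imp_fuzzy_Cauchy by blast
qed

lemma weak_G_complete_iff:
  assumes "fuzzy_complete X M"
  shows "weak_G_complete X M \<longleftrightarrow> G_Cauchy_subseq_Cauchy X M"
proof
  assume sub: "G_Cauchy_subseq_Cauchy X M"
  show "weak_G_complete X M"
    unfolding weak_G_complete_def
  proof (intro allI impI)
    fix \<sigma> assume "G_Cauchy X M \<sigma>"
    then obtain r :: "nat \<Rightarrow> nat" where r: "strict_mono r" "fuzzy_Cauchy X M (\<sigma> \<circ> r)"
      using sub unfolding G_Cauchy_subseq_Cauchy_def by blast
    then obtain l where "limitin (fuzzy_topology X M) (\<sigma> \<circ> r) l sequentially"
      using assms unfolding fuzzy_complete_def by blast
    then show "\<exists>l. cluster_point (fuzzy_topology X M) \<sigma> l"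
      by (intro exI[of _ l] cluster_point_subseq_limit[OF r(1)])
  qed
qed (fact weak_G_complete_imp_G_Cauchy_subseq_Cauchy)

lemma G_Cauchy_subseq_Cauchy_subset:
  assumes "G_Cauchy_subseq_Cauchy X M" "A \<subseteq> X"
  shows "G_Cauchy_subseq_Cauchy A M"
  unfolding G_Cauchy_subseq_Cauchy_def
proof (intro allI impI)
  fix \<sigma> assume \<sigma>: "G_Cauchy A M \<sigma>"
  then have "G_Cauchy X M \<sigma>"
    using assms(2) unfolding G_Cauchy_def by blast
  then obtain r :: "nat \<Rightarrow> nat" where r: "strict_mono r" "fuzzy_Cauchy X M (\<sigma> \<circ> r)"
    using assms(1) unfolding G_Cauchy_subseq_Cauchy_def by blast
  moreover have "range (\<sigma> \<circ> r) \<subseteq> A"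
    using \<sigma> by (auto simp: G_Cauchy_def)
  ultimately have "fuzzy_Cauchy A M (\<sigma> \<circ> r)"
    by (simp add: fuzzy_Cauchy_def)
  with r(1) show "\<exists>r. strict_mono r \<and> fuzzy_Cauchy A M (\<sigma> \<circ> r)"
    by blast
qed

text \<open>Write the terms of a Cauchy sequence in the range as \<open>\<sigma> (m k)\<close>. If some index \<open>m k\<close> recurs
  infinitely often, the sequence converges to the corresponding term. Otherwise the indices grow
  along a subsequence, which is then a Cauchy subsequence of \<open>\<sigma>\<close>.\<close>

lemma fuzzy_complete_range:
  assumes "range \<sigma> \<subseteq> X" "\<nexists>r::nat \<Rightarrow> nat. strict_mono r \<and> fuzzy_Cauchy X M (\<sigma> \<circ> r)"
  shows "fuzzy_complete (range \<sigma>) M"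
  unfolding fuzzy_complete_def
proof (intro allI impI)
  fix \<rho> assume \<rho>: "fuzzy_Cauchy (range \<sigma>) M \<rho>"
  interpret R: fuzzy_metric_space "range \<sigma>" M T
    using assms(1) by (intro fuzzy_metric_space_subset) auto
  have "\<rho> k \<in> range \<sigma>" for k
    using \<rho> unfolding fuzzy_Cauchy_def by blast
  then have "\<forall>k. \<exists>n. \<rho> k = \<sigma> n"
    by (simp add: image_iff)
  then obtain m where m: "\<And>k. \<rho> k = \<sigma> (m k)" by metis
  show "\<exists>l. limitin (fuzzy_topology (range \<sigma>) M) \<rho> l sequentially"
  proof (cases "\<exists>j. infinite {k. m k = j}")
    case True
    then obtain j r where r: "strict_mono (r :: nat \<Rightarrow> nat)" "\<And>k. m (r k) = j"
      using infinite_enumerate by blast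
    then have "\<rho> \<circ> r = (\<lambda>_. \<sigma> j)" using m by auto
    then have "limitin (fuzzy_topology (range \<sigma>) M) (\<rho> \<circ> r) (\<sigma> j) sequentially"
      by (simp add: limitin_def R.topspace_fuzzy_topology)
    then show ?thesis
      using R.fuzzy_Cauchy_subseq_limit[OF \<rho> r(1)] by blast
  next
    case False
    have later: "\<exists>k'>k. m k' > m k" for k
    proof -
      have "finite ({..k} \<union> (\<Union>j\<le>m k. {k'. m k' = j}))" using False by simp
      then obtain k' where "k' \<notin> {..k} \<union> (\<Union>j\<le>m k. {k'. m k' = j})"
        using ex_new_if_finite[OF infinite_UNIV_nat] by blast
      then show ?thesis by (intro exI[of _ k']) auto
    qed
    have "\<exists>r. \<forall>n. True \<and> (r n < r (Suc n) \<and> m (r n) < m (r (Suc n)))"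
      by (rule dependent_nat_choice) (use later in auto)
    then obtain r where "\<And>n. r n < r (Suc n)" "\<And>n. m (r n) < m (r (Suc n))"
      by auto
    then have "strict_mono r" "strict_mono (m \<circ> r)"
      by (simp_all add: strict_mono_Suc_iff)
    have "fuzzy_Cauchy X M (\<rho> \<circ> r)"
      unfolding fuzzy_Cauchy_def
    proof (intro conjI ballI allI impI)
      show "range (\<rho> \<circ> r) \<subseteq> X" using m assms(1) by auto
      fix \<epsilon> t :: real assume "\<epsilon> \<in> {0<..<1}" "t > 0"
      then obtain k where "\<forall>a\<ge>k. \<forall>b\<ge>k. M (\<rho> a) (\<rho> b) t > 1 - \<epsilon>"
        using \<rho> unfolding fuzzy_Cauchy_def by blast
      then show "\<exists>k. \<forall>a\<ge>k. \<forall>b\<ge>k. M ((\<rho> \<circ> r) a) ((\<rho> \<circ> r) b) t > 1 - \<epsilon>"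
        using seq_suble[OF \<open>strict_mono r\<close>] by (intro exI[of _ k]) (auto intro: order_trans)
    qed
    moreover have "\<rho> \<circ> r = \<sigma> \<circ> (m \<circ> r)" using m by auto
    ultimately show ?thesis
      using assms(2) \<open>strict_mono (m \<circ> r)\<close> by metis
  qed
qed

text \<open>It is enough to test the condition on ranges of sequences: the range of a G-Cauchy sequence
  without Cauchy subsequence would be a complete subspace in which that sequence clusters.\<close>

lemma complete_subspaces_weak_G_complete_iff:
  "(\<forall>A. A \<subseteq> X \<and> A \<noteq> {} \<and> fuzzy_complete A M \<longrightarrow> weak_G_complete A M) \<longleftrightarrow>
     G_Cauchy_subseq_Cauchy X M"
proof (intro iffI allI impI)
  fix A assume "G_Cauchy_subseq_Cauchy X M" "A \<subseteq> X \<and> A \<noteq> {} \<and> fuzzy_complete A M"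
  then show "weak_G_complete A M"
    using fuzzy_metric_space.weak_G_complete_iff[OF fuzzy_metric_space_subset, of A]
      G_Cauchy_subseq_Cauchy_subset by simp
next
  assume b: "\<forall>A. A \<subseteq> X \<and> A \<noteq> {} \<and> fuzzy_complete A M \<longrightarrow> weak_G_complete A M"
  show "G_Cauchy_subseq_Cauchy X M"
    unfolding G_Cauchy_subseq_Cauchy_def
  proof (intro allI impI, rule ccontr)
    fix \<sigma> assume G: "G_Cauchy X M \<sigma>"
      and no: "\<nexists>r::nat \<Rightarrow> nat. strict_mono r \<and> fuzzy_Cauchy X M (\<sigma> \<circ> r)"
    have \<sigma>: "range \<sigma> \<subseteq> X" using G by (simp add: G_Cauchy_def)
    interpret R: fuzzy_metric_space "range \<sigma>" M T
      using \<sigma> by (intro fuzzy_metric_space_subset) auto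
    have "weak_G_complete (range \<sigma>) M"
      using b \<sigma> fuzzy_complete_range[OF \<sigma> no] by blast
    moreover have "G_Cauchy (range \<sigma>) M \<sigma>" using G by (simp add: G_Cauchy_def)
    ultimately obtain r :: "nat \<Rightarrow> nat" where r: "strict_mono r" "fuzzy_Cauchy (range \<sigma>) M (\<sigma> \<circ> r)"
      using R.weak_G_complete_imp_G_Cauchy_subseq_Cauchy
      unfolding G_Cauchy_subseq_Cauchy_def by blast
    then have "fuzzy_Cauchy X M (\<sigma> \<circ> r)"
      using \<sigma> by (auto simp: fuzzy_Cauchy_def)
    with r(1) no show False by blast
  qed
qed

end

section \<open>Isometries onto dense subspaces\<close>

lemma fuzzy_isometry_fuzzy_close:
  assumes "fuzzy_isometry X M Y N \<phi>" "range u \<subseteq> X" "range v \<subseteq> X"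
  shows "fuzzy_close N F (\<phi> \<circ> u) (\<phi> \<circ> v) \<longleftrightarrow> fuzzy_close M F u v"
proof -
  have "N (\<phi> (u i)) (\<phi> (v i)) t = M (u i) (v i) t" if "t > 0" for i t
    using assms that by (auto simp: fuzzy_isometry_def subset_iff)
  then show ?thesis by (simp add: fuzzy_close_def)
qed

lemma fuzzy_isometry_G_Cauchy:
  assumes "fuzzy_isometry X M Y N \<phi>" "range \<sigma> \<subseteq> X"
  shows "G_Cauchy Y N (\<phi> \<circ> \<sigma>) \<longleftrightarrow> G_Cauchy X M \<sigma>"
proof -
  have "range (\<sigma> \<circ> Suc) \<subseteq> X" "range (\<phi> \<circ> \<sigma>) \<subseteq> Y"
    using assms by (auto simp: fuzzy_isometry_def)
  then show ?thesis
    using fuzzy_isometry_fuzzy_close[OF assms, of "\<sigma> \<circ> Suc"] assms(2)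
    by (simp add: G_Cauchy_iff_fuzzy_close comp_assoc)
qed

lemma fuzzy_isometry_fuzzy_Cauchy:
  assumes "fuzzy_isometry X M Y N \<phi>" "range \<sigma> \<subseteq> X"
  shows "fuzzy_Cauchy Y N (\<phi> \<circ> \<sigma>) \<longleftrightarrow> fuzzy_Cauchy X M \<sigma>"
proof -
  have "N (\<phi> (\<sigma> m)) (\<phi> (\<sigma> n)) t = M (\<sigma> m) (\<sigma> n) t" if "t > 0" for m n t
    using assms that by (auto simp: fuzzy_isometry_def subset_iff)
  moreover have "range (\<phi> \<circ> \<sigma>) \<subseteq> Y"
    using assms by (auto simp: fuzzy_isometry_def)
  ultimately show ?thesis
    using assms(2) by (simp add: fuzzy_Cauchy_def)
qed

text \<open>For the harder direction, a G-Cauchy sequence \<open>\<rho>\<close> of the large space is approximated by a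
  sequence \<open>\<phi> \<circ> \<sigma>\<close> from the dense subspace. By transitivity of closeness \<open>\<sigma>\<close> is again G-Cauchy, and
  the same indices that select a Cauchy subsequence of \<open>\<sigma>\<close> select one of \<open>\<rho>\<close>.\<close>

lemma G_Cauchy_subseq_Cauchy_dense_iff:
  assumes "fuzzy_metric_space Y N S" "fuzzy_isometry X M Y N \<phi>"
    and dense: "fuzzy_topology Y N closure_of (\<phi> ` X) = Y"
  shows "G_Cauchy_subseq_Cauchy Y N \<longleftrightarrow> G_Cauchy_subseq_Cauchy X M"
proof
  interpret Y: fuzzy_metric_space Y N S by fact
  assume Y: "G_Cauchy_subseq_Cauchy Y N"
  show "G_Cauchy_subseq_Cauchy X M"
    unfolding G_Cauchy_subseq_Cauchy_def
  proof (intro allI impI)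
    fix \<sigma> assume G: "G_Cauchy X M \<sigma>"
    then have \<sigma>: "range \<sigma> \<subseteq> X" by (simp add: G_Cauchy_def)
    then have "G_Cauchy Y N (\<phi> \<circ> \<sigma>)"
      using G fuzzy_isometry_G_Cauchy[OF assms(2)] by blast
    then obtain r :: "nat \<Rightarrow> nat" where r: "strict_mono r" "fuzzy_Cauchy Y N ((\<phi> \<circ> \<sigma>) \<circ> r)"
      using Y unfolding G_Cauchy_subseq_Cauchy_def by blast
    moreover have "range (\<sigma> \<circ> r) \<subseteq> X" using \<sigma> by auto
    ultimately show "\<exists>r. strict_mono r \<and> fuzzy_Cauchy X M (\<sigma> \<circ> r)"
      using fuzzy_isometry_fuzzy_Cauchy[OF assms(2), of "\<sigma> \<circ> r"] by (auto simp: comp_assoc)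
  qed
next
  interpret Y: fuzzy_metric_space Y N S by fact
  assume X: "G_Cauchy_subseq_Cauchy X M"
  show "G_Cauchy_subseq_Cauchy Y N"
    unfolding G_Cauchy_subseq_Cauchy_def
  proof (intro allI impI)
    fix \<rho> assume "G_Cauchy Y N \<rho>"
    then have \<rho>: "range \<rho> \<subseteq> Y" "fuzzy_close N sequentially \<rho> (\<rho> \<circ> Suc)"
      by (simp_all add: G_Cauchy_iff_fuzzy_close)
    define \<delta> :: "nat \<Rightarrow> real" where "\<delta> k = 1 / real (Suc k)" for k
    have \<delta>: "\<delta> k > 0" for k by (simp add: \<delta>_def)
    have "\<exists>x\<in>X. \<phi> x \<in> fuzzy_ball Y N (\<rho> n) (\<delta> n) (\<delta> n)" for n
    proof -
      have "\<rho> n \<in> Y" using \<rho>(1) by auto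
      moreover from this have "\<rho> n \<in> fuzzy_topology Y N closure_of (\<phi> ` X)"
        using dense by simp
      ultimately show ?thesis
        using Y.openin_fuzzy_ball[of "\<rho> n" "\<delta> n" "\<delta> n"]
          Y.centre_in_fuzzy_ball[of "\<rho> n" "\<delta> n" "\<delta> n"] \<delta>
        by (auto simp: in_closure_of)
    qed
    then obtain \<sigma> where \<sigma>: "\<And>n. \<sigma> n \<in> X" "\<And>n. \<phi> (\<sigma> n) \<in> fuzzy_ball Y N (\<rho> n) (\<delta> n) (\<delta> n)"
      by metis
    have \<sigma>X: "range \<sigma> \<subseteq> X" and \<sigma>Y: "range (\<phi> \<circ> \<sigma>) \<subseteq> Y"
      using \<sigma> by (auto simp: fuzzy_ball_def)
    have "\<delta> \<longlonglongrightarrow> 0"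
      unfolding \<delta>_def by (rule LIMSEQ_Suc[OF lim_1_over_n])
    then have close: "fuzzy_close N sequentially \<rho> (\<phi> \<circ> \<sigma>)"
      using \<sigma>(2) \<delta> \<rho>(1) \<sigma>Y by (intro Y.fuzzy_close_vanishing[where \<delta> = \<delta>]) (auto simp: fuzzy_ball_def)
    have "fuzzy_close N sequentially (\<phi> \<circ> \<sigma>) (\<phi> \<circ> \<sigma> \<circ> Suc)"
    proof -
      have SucY: "range (\<rho> \<circ> Suc) \<subseteq> Y" "range (\<phi> \<circ> \<sigma> \<circ> Suc) \<subseteq> Y"
        using \<rho>(1) \<sigma>Y by auto
      have "fuzzy_close N sequentially (\<phi> \<circ> \<sigma>) (\<rho> \<circ> Suc)"
        by (rule Y.fuzzy_close_trans[OF Y.fuzzy_close_sym[OF close \<rho>(1) \<sigma>Y] \<rho>(2) \<sigma>Y \<rho>(1) SucY(1)])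
      from Y.fuzzy_close_trans[OF this fuzzy_close_compose[OF close filterlim_Suc] \<sigma>Y SucY]
      show ?thesis .
    qed
    then have "G_Cauchy X M \<sigma>"
      using fuzzy_isometry_G_Cauchy[OF assms(2) \<sigma>X] \<sigma>Y by (simp add: G_Cauchy_iff_fuzzy_close)
    then obtain r :: "nat \<Rightarrow> nat" where r: "strict_mono r" "fuzzy_Cauchy X M (\<sigma> \<circ> r)"
      using X unfolding G_Cauchy_subseq_Cauchy_def by blast
    let ?F = "sequentially \<times>\<^sub>F sequentially :: (nat \<times> nat) filter"
    let ?\<alpha> = "\<phi> \<circ> (\<sigma> \<circ> r)" and ?\<beta> = "\<rho> \<circ> r"
    have "range (\<sigma> \<circ> r) \<subseteq> X" using \<sigma>X by auto
    then have "fuzzy_Cauchy Y N ?\<alpha>"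
      using fuzzy_isometry_fuzzy_Cauchy[OF assms(2)] r(2) by blast
    then have \<alpha>: "fuzzy_close N ?F (?\<alpha> \<circ> fst) (?\<alpha> \<circ> snd)"
      by (simp add: Y.fuzzy_Cauchy_iff_fuzzy_close)
    have \<beta>\<alpha>: "fuzzy_close N sequentially ?\<beta> ?\<alpha>"
      using fuzzy_close_compose[OF close filterlim_subseq[OF r(1)]] by (simp add: comp_assoc)
    have FY: "range (?\<beta> \<circ> fst) \<subseteq> Y" "range (?\<beta> \<circ> snd) \<subseteq> Y"
      "range (?\<alpha> \<circ> fst) \<subseteq> Y" "range (?\<alpha> \<circ> snd) \<subseteq> Y"
      using \<rho>(1) \<sigma>Y by auto
    have "fuzzy_close N ?F (?\<beta> \<circ> fst) (?\<alpha> \<circ> snd)"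
      by (rule Y.fuzzy_close_trans[OF fuzzy_close_compose[OF \<beta>\<alpha> filterlim_fst] \<alpha> FY(1,3,4)])
    moreover have "fuzzy_close N ?F (?\<alpha> \<circ> snd) (?\<beta> \<circ> snd)"
      by (rule Y.fuzzy_close_sym[OF fuzzy_close_compose[OF \<beta>\<alpha> filterlim_snd] FY(2,4)])
    ultimately have "fuzzy_close N ?F (?\<beta> \<circ> fst) (?\<beta> \<circ> snd)"
      by (rule Y.fuzzy_close_trans[OF _ _ FY(1,4,2)])
    then have "fuzzy_Cauchy Y N ?\<beta>"
      using \<rho>(1) by (auto simp: Y.fuzzy_Cauchy_iff_fuzzy_close)
    with r(1) show "\<exists>r. strict_mono r \<and> fuzzy_Cauchy Y N (\<rho> \<circ> r)" by blast
  qed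
qed

section \<open>Cauchy-continuous maps\<close>

lemma fuzzy_Cauchy_continuous_G_Cauchy:
  assumes "G_Cauchy_subseq_Cauchy X M" "fuzzy_Cauchy_continuous X M Y N f" "G_Cauchy X M \<sigma>"
  shows "fuzzy_cofinally_Cauchy Y N (f \<circ> \<sigma>)"
proof -
  obtain r :: "nat \<Rightarrow> nat" where r: "strict_mono r" "fuzzy_Cauchy X M (\<sigma> \<circ> r)"
    using assms(1,3) unfolding G_Cauchy_subseq_Cauchy_def by blast
  then have "fuzzy_Cauchy Y N ((f \<circ> \<sigma>) \<circ> r)"
    using assms(2) by (simp add: fuzzy_Cauchy_continuous_def comp_assoc)
  moreover have "f ` X \<subseteq> Y" "range \<sigma> \<subseteq> X"
    using assms(2,3) by (simp_all add: fuzzy_Cauchy_continuous_def G_Cauchy_def)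
  then have "range (f \<circ> \<sigma>) \<subseteq> Y"
    by (auto simp: image_subset_iff subset_iff)
  ultimately show ?thesis
    using r(1) by (intro fuzzy_Cauchy_imp_cofinally_Cauchy)
qed

lemma LIMSEQ_imp_fuzzy_Cauchy_standard:
  assumes "x \<longlonglongrightarrow> L"
  shows "fuzzy_Cauchy UNIV standard_fuzzy_metric x"
proof -
  interpret R: fuzzy_metric_space UNIV standard_fuzzy_metric "(*)"
    by (fact fuzzy_metric_space_standard)
  have "(\<lambda>n. t / (t + \<bar>L - x n\<bar>)) \<longlonglongrightarrow> t / (t + \<bar>L - L\<bar>)" if "t > 0" for t
    using that assms by (intro tendsto_intros) auto
  then have "fuzzy_close standard_fuzzy_metric sequentially (\<lambda>_. L) x"
    by (auto simp: fuzzy_close_def standard_fuzzy_metric_def)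
  then have "limitin (fuzzy_topology UNIV standard_fuzzy_metric) x L sequentially"
    by (simp add: R.limitin_iff_fuzzy_close)
  then show ?thesis
    by (rule R.limitin_imp_fuzzy_Cauchy) simp
qed

text \<open>Continuous functions need not preserve Cauchy sequences, but they preserve convergent ones,
  and in a complete space these are the same.\<close>

lemma fuzzy_Cauchy_continuous_completion:
  assumes "fuzzy_complete Y N" "fuzzy_isometry X M Y N \<phi>"
    and "continuous_map (fuzzy_topology Y N) euclideanreal f"
  shows "fuzzy_Cauchy_continuous X M UNIV standard_fuzzy_metric (f \<circ> \<phi>)"
  unfolding fuzzy_Cauchy_continuous_def
proof (intro conjI allI impI)
  fix \<sigma> assume \<sigma>: "fuzzy_Cauchy X M \<sigma>"
  then have "fuzzy_Cauchy Y N (\<phi> \<circ> \<sigma>)"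
    using fuzzy_isometry_fuzzy_Cauchy[OF assms(2)] by (auto simp: fuzzy_Cauchy_def)
  then obtain l where "limitin (fuzzy_topology Y N) (\<phi> \<circ> \<sigma>) l sequentially"
    using assms(1) unfolding fuzzy_complete_def by blast
  from continuous_map_limit[OF assms(3) this]
  show "fuzzy_Cauchy UNIV standard_fuzzy_metric (f \<circ> \<phi> \<circ> \<sigma>)"
    by (intro LIMSEQ_imp_fuzzy_Cauchy_standard) (simp add: comp_assoc)
qed simp

text \<open>If \<open>\<sigma>\<close> has no Cauchy subsequence, its image in the completion has no cluster point. So
  some continuous function sends each term of this image to the first index at which it occurs.
  Its values on the image are integers, so being cofinally Cauchy makes them constant on an infinite
  set of indices; a term of the image would recur infinitely often and be a cluster point.\<close>

lemma G_Cauchy_subseq_Cauchy_if_real_Cauchy_continuous: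
  assumes "fuzzy_metric_space Y N S" "fuzzy_complete Y N" "fuzzy_isometry X M Y N \<phi>"
    and d: "\<And>f \<sigma>. \<lbrakk>fuzzy_Cauchy_continuous X M UNIV standard_fuzzy_metric f; G_Cauchy X M \<sigma>\<rbrakk>
      \<Longrightarrow> fuzzy_cofinally_Cauchy UNIV standard_fuzzy_metric (f \<circ> \<sigma>)"
  shows "G_Cauchy_subseq_Cauchy X M"
  unfolding G_Cauchy_subseq_Cauchy_def
proof (intro allI impI, rule ccontr)
  interpret Y: fuzzy_metric_space Y N S by fact
  let ?\<tau> = "fuzzy_topology Y N"
  fix \<sigma> assume G: "G_Cauchy X M \<sigma>"
    and no: "\<nexists>r::nat \<Rightarrow> nat. strict_mono r \<and> fuzzy_Cauchy X M (\<sigma> \<circ> r)"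
  define \<rho> where "\<rho> = \<phi> \<circ> \<sigma>"
  have \<sigma>: "range \<sigma> \<subseteq> X" using G by (simp add: G_Cauchy_def)
  then have \<rho>: "range \<rho> \<subseteq> Y" using assms(3) by (auto simp: \<rho>_def fuzzy_isometry_def)
  have no_cluster: "\<nexists>l. cluster_point ?\<tau> \<rho> l"
  proof
    assume "\<exists>l. cluster_point ?\<tau> \<rho> l"
    then obtain l r where r: "strict_mono (r :: nat \<Rightarrow> nat)" "limitin ?\<tau> (\<rho> \<circ> r) l sequentially"
      using Y.cluster_point_iff_subseq[OF \<rho>] by blast
    have "range (\<rho> \<circ> r) \<subseteq> Y" "range (\<sigma> \<circ> r) \<subseteq> X" using \<rho> \<sigma> by auto
    then have "fuzzy_Cauchy X M (\<sigma> \<circ> r)"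
      using Y.limitin_imp_fuzzy_Cauchy[OF r(2)] fuzzy_isometry_fuzzy_Cauchy[OF assms(3)]
      by (simp add: \<rho>_def comp_assoc)
    with r(1) no show False by blast
  qed
  define first where "first y = (LEAST n. \<rho> n = y)" for y
  have first: "\<rho> (first (\<rho> n)) = \<rho> n" for n
    unfolding first_def by (rule LeastI) simp
  obtain f where f: "continuous_map ?\<tau> euclideanreal f" "\<And>n. f (\<rho> n) = real (first (\<rho> n))"
    using continuous_extension_no_cluster_point[of ?\<tau> \<rho> "\<lambda>y. real (first y)"]
      Y.normal_space_fuzzy_topology Y.t1_space_fuzzy_topology \<rho> no_cluster
    unfolding Y.topspace_fuzzy_topology by blast
  have "fuzzy_cofinally_Cauchy UNIV standard_fuzzy_metric (f \<circ> \<phi> \<circ> \<sigma>)"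
    using d fuzzy_Cauchy_continuous_completion[OF assms(2,3) f(1)] G by blast
  \<comment> \<open>At time 1, nearness above \<open>1 / 2\<close> means a distance below 1.\<close>
  then have "\<exists>I. infinite I \<and>
      (\<forall>p\<in>I. \<forall>q\<in>I. standard_fuzzy_metric ((f \<circ> \<phi> \<circ> \<sigma>) p) ((f \<circ> \<phi> \<circ> \<sigma>) q) 1 > 1 - 1 / 2)"
    unfolding fuzzy_cofinally_Cauchy_def
    by (elim conjE ballE[of _ _ "1 / 2"]) auto
  then obtain I where I: "infinite I"
    "\<And>p q. \<lbrakk>p \<in> I; q \<in> I\<rbrakk> \<Longrightarrow> standard_fuzzy_metric (f (\<rho> p)) (f (\<rho> q)) 1 > 1 / 2"
    by (auto simp: \<rho>_def)
  have const: "\<rho> p = \<rho> q" if "p \<in> I" "q \<in> I" for p q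
  proof -
    have "1 / (1 + \<bar>real (first (\<rho> p)) - real (first (\<rho> q))\<bar>) > 1 / 2"
      using I(2)[OF that] by (simp add: standard_fuzzy_metric_def f(2))
    then have "\<bar>real (first (\<rho> p)) - real (first (\<rho> q))\<bar> < 1"
      by (simp add: field_simps)
    then have "first (\<rho> p) = first (\<rho> q)" by linarith
    then show ?thesis using first by metis
  qed
  obtain p where p: "p \<in> I" using I(1) infinite_imp_nonempty by blast
  have "I \<subseteq> {n. \<rho> n = \<rho> p}" using const p by blast
  then have "infinite {n. \<rho> n = \<rho> p}" using I(1) finite_subset by blast
  moreover have "\<rho> p \<in> topspace ?\<tau>" using \<rho> by (auto simp: Y.topspace_fuzzy_topology)
  ultimately show False
    using no_cluster cluster_point_infinitely_often by metis
qed

section \<open>The equivalence\<close>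

(* Condition (c) ranges over spaces (Y, N, S) on all types, which no HOL formula can
   quantify over. "(a) implies (c)" is therefore stated for an arbitrary type 'c, and
   "(c) implies (a)" uses (c) only for spaces carried by sets of reals. *)

theorem theorem3p3:
  fixes X :: "'a set" and M :: "'a \<Rightarrow> 'a \<Rightarrow> real \<Rightarrow> real" and T :: "real \<Rightarrow> real \<Rightarrow> real"
    and X' :: "'b set" and M' :: "'b \<Rightarrow> 'b \<Rightarrow> real \<Rightarrow> real" and T' :: "real \<Rightarrow> real \<Rightarrow> real"
  assumes "fuzzy_metric_space X M T"
    and "fuzzy_completion X M X' M' T'"
  shows
    "(weak_G_complete X' M' \<longleftrightarrow>
        (\<forall>A. A \<subseteq> X \<and> A \<noteq> {} \<and> fuzzy_complete A M \<longrightarrow> weak_G_complete A M))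
     \<and>
     (weak_G_complete X' M' \<longrightarrow>
        (\<forall>(Y :: 'c set) N S f.
           fuzzy_metric_space Y N S \<and> fuzzy_Cauchy_continuous X M Y N f \<longrightarrow>
           (\<forall>\<sigma>. G_Cauchy X M \<sigma> \<longrightarrow> fuzzy_cofinally_Cauchy Y N (f \<circ> \<sigma>))))
     \<and>
     ((\<forall>(Y :: real set) N S f.
           fuzzy_metric_space Y N S \<and> fuzzy_Cauchy_continuous X M Y N f \<longrightarrow>
           (\<forall>\<sigma>. G_Cauchy X M \<sigma> \<longrightarrow> fuzzy_cofinally_Cauchy Y N (f \<circ> \<sigma>)))
        \<longrightarrow> weak_G_complete X' M')
     \<and>
     (weak_G_complete X' M' \<longleftrightarrow>
        (\<forall>f. fuzzy_Cauchy_continuous X M UNIV standard_fuzzy_metric f \<longrightarrow>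
           (\<forall>\<sigma>. G_Cauchy X M \<sigma> \<longrightarrow>
              fuzzy_cofinally_Cauchy UNIV standard_fuzzy_metric (f \<circ> \<sigma>))))
     \<and>
     (weak_G_complete X' M' \<longleftrightarrow>
        (\<forall>\<sigma>. G_Cauchy X M \<sigma> \<longrightarrow>
           (\<exists>r :: nat \<Rightarrow> nat. strict_mono r \<and> fuzzy_Cauchy X M (\<sigma> \<circ> r))))"
proof -
  interpret X: fuzzy_metric_space X M T by fact
  interpret X': fuzzy_metric_space X' M' T'
    using assms(2) by (simp add: fuzzy_completion_def)
  have complete: "fuzzy_complete X' M'"
    using assms(2) by (simp add: fuzzy_completion_def)
  obtain \<phi> where \<phi>: "fuzzy_isometry X M X' M' \<phi>" "fuzzy_topology X' M' closure_of (\<phi> ` X) = X'"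
    using assms(2)
    by (auto simp: fuzzy_completion_def fuzzy_isometric_def fuzzy_isometry_def
          X'.topspace_fuzzy_topology)
  have ae: "weak_G_complete X' M' \<longleftrightarrow> G_Cauchy_subseq_Cauchy X M"
    using X'.weak_G_complete_iff[OF complete]
      G_Cauchy_subseq_Cauchy_dense_iff[OF X'.fuzzy_metric_space_axioms \<phi>] by simp
  let ?d = "\<forall>f. fuzzy_Cauchy_continuous X M UNIV standard_fuzzy_metric f \<longrightarrow>
    (\<forall>\<sigma>. G_Cauchy X M \<sigma> \<longrightarrow> fuzzy_cofinally_Cauchy UNIV standard_fuzzy_metric (f \<circ> \<sigma>))"
  have d: "G_Cauchy_subseq_Cauchy X M" if ?d
    using that
    by (intro G_Cauchy_subseq_Cauchy_if_real_Cauchy_continuous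
          [OF X'.fuzzy_metric_space_axioms complete \<phi>(1)]) blast
  show ?thesis
    unfolding ae X.complete_subspaces_weak_G_complete_iff
  proof (intro conjI)
    show "G_Cauchy_subseq_Cauchy X M \<longrightarrow>
        (\<forall>(Y :: 'c set) N S f.
           fuzzy_metric_space Y N S \<and> fuzzy_Cauchy_continuous X M Y N f \<longrightarrow>
           (\<forall>\<sigma>. G_Cauchy X M \<sigma> \<longrightarrow> fuzzy_cofinally_Cauchy Y N (f \<circ> \<sigma>)))"
      by (blast intro: fuzzy_Cauchy_continuous_G_Cauchy)
    show "(\<forall>(Y :: real set) N S f.
           fuzzy_metric_space Y N S \<and> fuzzy_Cauchy_continuous X M Y N f \<longrightarrow>
           (\<forall>\<sigma>. G_Cauchy X M \<sigma> \<longrightarrow> fuzzy_cofinally_Cauchy Y N (f \<circ> \<sigma>)))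
        \<longrightarrow> G_Cauchy_subseq_Cauchy X M"
      using d fuzzy_metric_space_standard by blast
    show "G_Cauchy_subseq_Cauchy X M \<longleftrightarrow> ?d"
      using d fuzzy_Cauchy_continuous_G_Cauchy by blast
  qed (simp_all add: G_Cauchy_subseq_Cauchy_def)
qed

end
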